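(* There is an algorithm that, given positive real numbers $\ell_1,\dots,\ell_n$ (the lengths of the $n$ segments of a carpenter's ruler), computes in $O(n)$ time the shortest length into which the ruler can be wrapped, i.e. the quantity \[ W(\ell_1,\dots,\ell_n)=\min \max(t_1,\dots,t_m), \] where the minimum ranges over all $m\ge 1$ and all partitions of the sequence $\ell_1,\dots,\ell_n$ into $m$ nonempty consecutive blocks with block sums $t_1,\dots,t_m$ satisfying $t_1\le t_2\le\cdots\le t_{m-1}$ (no constraint is placed on $t_m$).
   Context: A carpenter's ruler consists of $n$ segments of given positive lengths $\ell_1,\dots,\ell_n$ joined end to end by hinges; segments have width $0$ and folds are points. Wrapping the ruler means folding some subset of the hinges by 180 degrees, all in the same rotational direction (all clockwise or all counter-clockwise), so that the ruler lies on a line; the length of the wrapping is the length of the interval it occupies. If the folded hinges split the ruler into consecutive pieces of total lengths $t_1,\dots,t_m$ (from one end to the other), such a same-direction wrapping exists exactly when $t_1\le t_2\le\cdots\le t_{m-1}$ (the last piece may be shorter, in which case it lies inside the previous turn), and its length is then $\max(t_1,\dots,t_m)$. Running times are in a model where arithmetic operations and comparisons on the input numbers take constant time. *)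

theory Defs
  imports Complex_Main "HOL-Library.Landau_Symbols"
begin

subsection \<open>Wrapping a ruler\<close>

definition ruler :: "real list \<Rightarrow> bool" where
  "ruler ls \<longleftrightarrow> ls \<noteq> [] \<and> (\<forall>l \<in> set ls. l > 0)"

text \<open>A wrapping is given by its list of consecutive blocks of segments; the condition on the
  block sums \<open>t\<^sub>1, \<dots>, t\<^sub>m\<close> concerns all of them but the last.\<close>

definition wrappings :: "real list \<Rightarrow> real list list set" where
  "wrappings ls =
     {bs. bs \<noteq> [] \<and> (\<forall>b \<in> set bs. b \<noteq> []) \<and> concat bs = ls \<and> sorted (butlast (map sum_list bs))}"

definition wrap_length :: "real list list \<Rightarrow> real" where
  "wrap_length bs = Max (set (map sum_list bs))"

definition W :: "real list \<Rightarrow> real" where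
  "W ls = Min (wrap_length ` wrappings ls)"

text \<open>The minimum is over a finite nonempty set, so that \<^const>\<open>Min\<close> is meaningful.\<close>

lemma length_le_length_concat:
  "\<forall>b \<in> set bs. b \<noteq> [] \<Longrightarrow> length bs \<le> length (concat bs)"
proof (induction bs)
  case (Cons b bs)
  then have "length b \<ge> 1" by (simp add: Suc_le_eq)
  with Cons show ?case by simp
qed simp

lemma finite_wrappings: "finite (wrappings ls)"
proof (rule finite_subset)
  let ?B = "{b. set b \<subseteq> set ls \<and> length b \<le> length ls}"
  show "finite {bs. set bs \<subseteq> ?B \<and> length bs \<le> length ls}"
    by (intro finite_lists_length_le) simp
  show "wrappings ls \<subseteq> {bs. set bs \<subseteq> ?B \<and> length bs \<le> length ls}"
  proof
    fix bs assume bs: "bs \<in> wrappings ls"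
    have "length b \<le> length (concat bs)" if "b \<in> set bs" for b
      using that by (induction bs) auto
    with bs length_le_length_concat[of bs]
    show "bs \<in> {bs. set bs \<subseteq> ?B \<and> length bs \<le> length ls}"
      by (auto simp: wrappings_def)
  qed
qed

lemma wrappings_nonempty: "ls \<noteq> [] \<Longrightarrow> wrappings ls \<noteq> {}"
  by (auto simp: wrappings_def intro!: exI[of _ "[ls]"])


subsection \<open>A real RAM\<close>

text \<open>
  Running times refer to a two-sorted random access machine: natural numbers serve as indices and
  counters, real numbers hold the data. Both sorts have scalar variables and unbounded arrays with
  random access. Reals are accessible only through the field operations and comparisons, and
  cannot be converted to natural numbers; the only real constants are 0 and 1. Naturals can only be
  added, subtracted and compared. Every constant, variable access, array access, arithmetic
  operation, comparison, Boolean operation, store and branch costs one unit of time.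
\<close>

type_synonym vname = string

record state =
  nvar :: "vname \<Rightarrow> nat"
  rvar :: "vname \<Rightarrow> real"
  narr :: "vname \<Rightarrow> nat \<Rightarrow> nat"
  rarr :: "vname \<Rightarrow> nat \<Rightarrow> real"

datatype nexp =
    NConst nat
  | NVar vname
  | NArr vname nexp
  | NAdd nexp nexp
  | NSub nexp nexp

datatype rexp =
    RZero
  | ROne
  | RVar vname
  | RArr vname nexp
  | RAdd rexp rexp
  | RSub rexp rexp
  | RMul rexp rexp
  | RDiv rexp rexp

datatype bexp =
    NLess nexp nexp
  | RLess rexp rexp
  | BNot bexp
  | BAnd bexp bexp

datatype com =
    Skip
  | NAssign vname nexp
  | RAssign vname rexp
  | NStore vname nexp nexp
  | RStore vname nexp rexp
  | Seq com com
  | Cond bexp com com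
  | While bexp com

primrec nval :: "nexp \<Rightarrow> state \<Rightarrow> nat" where
  "nval (NConst k) s = k"
| "nval (NVar x) s = nvar s x"
| "nval (NArr a i) s = narr s a (nval i s)"
| "nval (NAdd e f) s = nval e s + nval f s"
| "nval (NSub e f) s = nval e s - nval f s"

primrec rval :: "rexp \<Rightarrow> state \<Rightarrow> real" where
  "rval RZero s = 0"
| "rval ROne s = 1"
| "rval (RVar x) s = rvar s x"
| "rval (RArr a i) s = rarr s a (nval i s)"
| "rval (RAdd e f) s = rval e s + rval f s"
| "rval (RSub e f) s = rval e s - rval f s"
| "rval (RMul e f) s = rval e s * rval f s"
| "rval (RDiv e f) s = rval e s / rval f s"

primrec bval :: "bexp \<Rightarrow> state \<Rightarrow> bool" where
  "bval (NLess e f) s \<longleftrightarrow> nval e s < nval f s"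
| "bval (RLess e f) s \<longleftrightarrow> rval e s < rval f s"
| "bval (BNot b) s \<longleftrightarrow> \<not> bval b s"
| "bval (BAnd b c) s \<longleftrightarrow> bval b s \<and> bval c s"

primrec ncost :: "nexp \<Rightarrow> nat" where
  "ncost (NConst k) = 1"
| "ncost (NVar x) = 1"
| "ncost (NArr a i) = ncost i + 1"
| "ncost (NAdd e f) = ncost e + ncost f + 1"
| "ncost (NSub e f) = ncost e + ncost f + 1"

primrec rcost :: "rexp \<Rightarrow> nat" where
  "rcost RZero = 1"
| "rcost ROne = 1"
| "rcost (RVar x) = 1"
| "rcost (RArr a i) = ncost i + 1"
| "rcost (RAdd e f) = rcost e + rcost f + 1"
| "rcost (RSub e f) = rcost e + rcost f + 1"
| "rcost (RMul e f) = rcost e + rcost f + 1"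
| "rcost (RDiv e f) = rcost e + rcost f + 1"

primrec bcost :: "bexp \<Rightarrow> nat" where
  "bcost (NLess e f) = ncost e + ncost f + 1"
| "bcost (RLess e f) = rcost e + rcost f + 1"
| "bcost (BNot b) = bcost b + 1"
| "bcost (BAnd b c) = bcost b + bcost c + 1"

text \<open>\<open>exec c s t s'\<close>: started in \<open>s\<close>, the program \<open>c\<close> terminates in \<open>s'\<close> after \<open>t\<close> units of time.\<close>

inductive exec :: "com \<Rightarrow> state \<Rightarrow> nat \<Rightarrow> state \<Rightarrow> bool" where
  Skip: "exec Skip s 1 s"
| NAssign: "exec (NAssign x e) s (ncost e + 1) (s\<lparr>nvar := (nvar s)(x := nval e s)\<rparr>)"
| RAssign: "exec (RAssign x e) s (rcost e + 1) (s\<lparr>rvar := (rvar s)(x := rval e s)\<rparr>)"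
| NStore: "exec (NStore a i e) s (ncost i + ncost e + 1)
    (s\<lparr>narr := (narr s)(a := (narr s a)(nval i s := nval e s))\<rparr>)"
| RStore: "exec (RStore a i e) s (ncost i + rcost e + 1)
    (s\<lparr>rarr := (rarr s)(a := (rarr s a)(nval i s := rval e s))\<rparr>)"
| Seq: "exec c s t s' \<Longrightarrow> exec d s' u s'' \<Longrightarrow> exec (Seq c d) s (t + u) s''"
| CondTrue: "bval b s \<Longrightarrow> exec c s t s' \<Longrightarrow> exec (Cond b c d) s (bcost b + t + 1) s'"
| CondFalse: "\<not> bval b s \<Longrightarrow> exec d s t s' \<Longrightarrow> exec (Cond b c d) s (bcost b + t + 1) s'"
| WhileFalse: "\<not> bval b s \<Longrightarrow> exec (While b c) s (bcost b + 1) s"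
| WhileTrue: "bval b s \<Longrightarrow> exec c s t s' \<Longrightarrow> exec (While b c) s' u s'' \<Longrightarrow>
    exec (While b c) s (bcost b + t + u + 1) s''"

inductive_cases exec_elims:
  "exec Skip s t s'" "exec (NAssign x e) s t s'" "exec (RAssign x r) s t s'"
  "exec (NStore a i e) s t s'" "exec (RStore a i r) s t s'" "exec (Seq c d) s t s'"
  "exec (Cond b c d) s t s'" "exec (While b c) s t s'"

lemma exec_deterministic: "exec c s t s' \<Longrightarrow> exec c s t2 s2 \<Longrightarrow> t2 = t \<and> s2 = s'"
proof (induction arbitrary: t2 s2 rule: exec.induct)
  case (Seq c s t s' d u s'')
  from Seq.prems obtain t1 s1 u1 where
    "t2 = t1 + u1" "exec c s t1 s1" "exec d s1 u1 s2" by (rule exec_elims(6))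
  with Seq.IH show ?case by metis
next
  case (CondTrue b s c t s' d)
  from CondTrue.prems CondTrue.hyps obtain t1 where
    "t2 = bcost b + t1 + 1" "exec c s t1 s2" by (auto elim: exec_elims(7))
  with CondTrue.IH show ?case by metis
next
  case (CondFalse b s d t s' c)
  from CondFalse.prems CondFalse.hyps obtain t1 where
    "t2 = bcost b + t1 + 1" "exec d s t1 s2" by (auto elim: exec_elims(7))
  with CondFalse.IH show ?case by metis
next
  case (WhileFalse b s c)
  from WhileFalse.prems show ?case by (rule exec_elims(8)) (use WhileFalse.hyps in simp_all)
next
  case (WhileTrue b s c t s' u s'')
  from WhileTrue.prems obtain t1 s1 u1 where
    "t2 = bcost b + t1 + u1 + 1" "exec c s t1 s1" "exec (While b c) s1 u1 s2"
    by (rule exec_elims(8)) (use WhileTrue.hyps in simp_all)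
  with WhileTrue.IH show ?case by metis
qed (erule exec_elims(1-5); simp)+

text \<open>The input array is indexed from 0; all memory not holding the input is initially 0.\<close>

definition initial :: "real list \<Rightarrow> state" where
  "initial ls = \<lparr>nvar = (\<lambda>_. 0)(''n'' := length ls),
                 rvar = (\<lambda>_. 0),
                 narr = (\<lambda>_ _. 0),
                 rarr = (\<lambda>_ _. 0)(''input'' := (\<lambda>i. if i < length ls then ls ! i else 0))\<rparr>"

definition result_of :: "state \<Rightarrow> real" where
  "result_of s = rvar s ''output''"

end

theory Submission
  imports Defs
begin

text \<open>
  Let \<open>S j\<close> be the sum of the first \<open>j\<close> segments and \<open>g j\<close> the least possible last block sum of
  a partition of these segments into blocks with nondecreasing sums. A last block starting at
  position \<open>i\<close> is admissible for \<open>j\<close> iff \<open>S i + g i \<le> S j\<close>, hence \<open>g j = S j - S i\<close> for the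
  largest such \<open>i < j\<close>, and \<open>W\<close> is the minimum of \<open>max (g i) (S n - S i)\<close> over \<open>i < n\<close>. As \<open>S\<close>
  increases, an \<open>i\<close> stays admissible once it is so, and \<open>i\<close> is useless if a later position has a
  key \<open>S i + g i\<close> that is not larger. A queue of positions with strictly increasing keys therefore
  finds all the optimal \<open>i\<close>; every position is inserted once and removed at most once.
\<close>

subsection \<open>Prefix sums\<close>

definition prefix_sum :: "'a::monoid_add list \<Rightarrow> nat \<Rightarrow> 'a" where
  "prefix_sum xs i = sum_list (take i xs)"

lemma prefix_sum_0 [simp]: "prefix_sum xs 0 = 0"
  by (simp add: prefix_sum_def)

lemma prefix_sum_Suc: "i < length xs \<Longrightarrow> prefix_sum xs (Suc i) = prefix_sum xs i + xs ! i"
  by (simp add: prefix_sum_def take_Suc_conv_app_nth)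

lemma prefix_sum_length [simp]: "prefix_sum xs (length xs) = sum_list xs"
  by (simp add: prefix_sum_def)

lemma prefix_sum_take: "i \<le> j \<Longrightarrow> prefix_sum (take j xs) i = prefix_sum xs i"
  by (simp add: prefix_sum_def min_def)

lemma sum_list_drop:
  fixes xs :: "'a::ab_group_add list"
  shows "sum_list (drop i xs) = sum_list xs - prefix_sum xs i"
proof -
  have "sum_list xs = prefix_sum xs i + sum_list (drop i xs)"
    unfolding prefix_sum_def by (metis append_take_drop_id sum_list_append)
  then show ?thesis by simp
qed

lemma prefix_sum_strict_mono:
  fixes xs :: "'a::ordered_cancel_comm_monoid_add list"
  assumes "\<forall>x \<in> set xs. 0 < x" "i < j" "j \<le> length xs"
  shows "prefix_sum xs i < prefix_sum xs j"
  using assms(2,3)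
proof (induction j)
  case (Suc j)
  then have "prefix_sum xs i \<le> prefix_sum xs j" "0 < xs ! j"
    using assms(1) by (auto simp: less_Suc_eq)
  from add_le_less_mono[OF this] Suc.prems show ?case by (simp add: prefix_sum_Suc)
qed simp

lemma sum_list_drop_pos:
  fixes xs :: "'a::ordered_ab_group_add list"
  assumes "\<forall>x \<in> set xs. 0 < x" "i < length xs"
  shows "0 < sum_list (drop i xs)"
  using prefix_sum_strict_mono[OF assms order_refl] by (simp add: sum_list_drop)


subsection \<open>Partitions with nondecreasing block sums\<close>

definition partitions :: "'a list \<Rightarrow> 'a list list set" where
  "partitions xs = {bs. (\<forall>b \<in> set bs. b \<noteq> []) \<and> concat bs = xs}"

lemma partitions_Nil [simp]: "partitions [] = {[]}"
  by (auto simp: partitions_def)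

lemma partitions_eq_UN_snoc:
  assumes "xs \<noteq> []"
  shows "partitions xs = (\<Union>i<length xs. (\<lambda>bs. bs @ [drop i xs]) ` partitions (take i xs))"
proof (intro equalityI subsetI)
  fix bs assume bs: "bs \<in> partitions xs"
  with assms obtain cs b where snoc: "bs = cs @ [b]"
    by (cases bs rule: rev_cases) (auto simp: partitions_def)
  with bs have "concat cs @ b = xs" "b \<noteq> []" by (auto simp: partitions_def)
  then have "length (concat cs) < length xs" "concat cs = take (length (concat cs)) xs"
    "b = drop (length (concat cs)) xs"
    by auto
  with bs snoc show "bs \<in> (\<Union>i<length xs. (\<lambda>bs. bs @ [drop i xs]) ` partitions (take i xs))"
    unfolding partitions_def by auto
qed (auto simp: partitions_def)

lemma finite_partitions: "finite (partitions xs)"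
proof (induction xs rule: measure_induct_rule[of length])
  case (less xs)
  then show ?case by (cases "xs = []") (simp_all add: partitions_eq_UN_snoc)
qed

definition sorted_partitions :: "'a::{linorder,monoid_add} list \<Rightarrow> 'a list list set" where
  "sorted_partitions xs = {bs \<in> partitions xs. sorted (map sum_list bs)}"

definition last_sum :: "'a::monoid_add list list \<Rightarrow> 'a" where
  "last_sum bs = last (0 # map sum_list bs)"

definition min_last_sum :: "'a::{linorder,monoid_add} list \<Rightarrow> 'a" where
  "min_last_sum xs = Min (last_sum ` sorted_partitions xs)"

lemma sorted_partitions_Nil [simp]: "sorted_partitions [] = {[]}"
  by (auto simp: sorted_partitions_def)

lemma last_sum_snoc [simp]: "last_sum (bs @ [b]) = sum_list b"
  by (simp add: last_sum_def)

lemma min_last_sum_Nil [simp]: "min_last_sum [] = 0"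
  by (simp add: min_last_sum_def last_sum_def)

lemma finite_sorted_partitions: "finite (sorted_partitions xs)"
  by (simp add: sorted_partitions_def finite_partitions)

lemma sorted_partitions_nonempty: "sorted_partitions xs \<noteq> {}"
proof (cases "xs = []")
  case False
  then have "[xs] \<in> sorted_partitions xs" by (simp add: sorted_partitions_def partitions_def)
  then show ?thesis by blast
qed simp

lemma min_last_sum_le: "bs \<in> sorted_partitions xs \<Longrightarrow> min_last_sum xs \<le> last_sum bs"
  by (simp add: min_last_sum_def finite_sorted_partitions)

lemma min_last_sum_in: "min_last_sum xs \<in> last_sum ` sorted_partitions xs"
  unfolding min_last_sum_def
  by (intro Min_in) (simp_all add: finite_sorted_partitions sorted_partitions_nonempty)

lemma sorted_snoc_iff: "sorted (xs @ [x]) \<longleftrightarrow> sorted xs \<and> (xs \<noteq> [] \<longrightarrow> last xs \<le> x)"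
  by (cases xs rule: rev_cases) (auto simp: sorted_append)

lemma sorted_partitions_eq_UN_snoc:
  fixes xs :: "'a::linordered_ab_group_add list"
  assumes "xs \<noteq> []" "\<forall>x \<in> set xs. 0 < x"
  shows "sorted_partitions xs = (\<Union>i<length xs. (\<lambda>bs. bs @ [drop i xs]) `
    {bs \<in> sorted_partitions (take i xs). last_sum bs \<le> sum_list (drop i xs)})"
proof -
  have "sorted (map sum_list (bs @ [drop i xs])) \<longleftrightarrow>
      sorted (map sum_list bs) \<and> last_sum bs \<le> sum_list (drop i xs)" if "i < length xs" for i bs
    using sum_list_drop_pos[OF assms(2) that] by (auto simp: sorted_snoc_iff last_sum_def)
  then show ?thesis
    unfolding sorted_partitions_def partitions_eq_UN_snoc[OF assms(1)] by fastforce
qed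

lemma last_sum_image_sorted_partitions:
  fixes xs :: "'a::linordered_ab_group_add list"
  assumes "xs \<noteq> []" "\<forall>x \<in> set xs. 0 < x"
  shows "last_sum ` sorted_partitions xs =
    {sum_list (drop i xs) |i. i < length xs \<and> min_last_sum (take i xs) \<le> sum_list (drop i xs)}"
proof -
  have admissible: "(\<exists>bs \<in> sorted_partitions (take i xs). last_sum bs \<le> y) \<longleftrightarrow>
      min_last_sum (take i xs) \<le> y" for i y
    using min_last_sum_in[of "take i xs"] by (auto intro: min_last_sum_le order_trans)
  have "last_sum ` sorted_partitions xs = {sum_list (drop i xs) |i. i < length xs \<and>
      (\<exists>bs \<in> sorted_partitions (take i xs). last_sum bs \<le> sum_list (drop i xs))}"
    unfolding sorted_partitions_eq_UN_snoc[OF assms] image_UN image_image last_sum_snoc by blast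
  then show ?thesis by (simp only: admissible)
qed

lemma min_last_sum_pos:
  fixes xs :: "'a::linordered_ab_group_add list"
  assumes "xs \<noteq> []" "\<forall>x \<in> set xs. 0 < x"
  shows "0 < min_last_sum xs"
  using min_last_sum_in[of xs] sum_list_drop_pos[OF assms(2)]
  unfolding last_sum_image_sorted_partitions[OF assms] by auto

lemma min_last_sum_eq_sum_list_drop:
  fixes xs :: "'a::linordered_ab_group_add list"
  assumes pos: "\<forall>x \<in> set xs. 0 < x" and i: "i < length xs"
    and admissible: "min_last_sum (take i xs) \<le> sum_list (drop i xs)"
    and largest: "\<And>k. i < k \<Longrightarrow> k < length xs \<Longrightarrow> sum_list (drop k xs) < min_last_sum (take k xs)"
  shows "min_last_sum xs = sum_list (drop i xs)"
  unfolding min_last_sum_def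
proof (rule Min_eqI)
  have nonempty: "xs \<noteq> []" using i by auto
  show "sum_list (drop i xs) \<in> last_sum ` sorted_partitions xs"
    using i admissible by (auto simp: last_sum_image_sorted_partitions[OF nonempty pos])
  fix y assume "y \<in> last_sum ` sorted_partitions xs"
  then obtain k where k: "k < length xs" "min_last_sum (take k xs) \<le> sum_list (drop k xs)"
    and y: "y = sum_list (drop k xs)"
    by (auto simp: last_sum_image_sorted_partitions[OF nonempty pos])
  have "k \<le> i" using largest[of k] k by force
  then have "prefix_sum xs k \<le> prefix_sum xs i"
    using prefix_sum_strict_mono[OF pos, of k i] i by (cases "k = i") auto
  then show "sum_list (drop i xs) \<le> y" by (simp add: y sum_list_drop)
qed (simp add: finite_sorted_partitions)

definition key :: "'a::{linorder,monoid_add} list \<Rightarrow> nat \<Rightarrow> 'a" where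
  "key xs i = prefix_sum xs i + min_last_sum (take i xs)"

lemma key_0 [simp]: "key xs 0 = 0"
  by (simp add: key_def)

lemma prefix_sum_less_key:
  fixes xs :: "'a::linordered_ab_group_add list"
  assumes "\<forall>x \<in> set xs. 0 < x" "0 < i" "i \<le> length xs"
  shows "prefix_sum xs i < key xs i"
proof -
  have "\<forall>x \<in> set (take i xs). 0 < x" using assms(1) by (auto dest: in_set_takeD)
  then have "0 < min_last_sum (take i xs)" using assms(2,3) by (intro min_last_sum_pos) auto
  then show ?thesis by (simp add: key_def)
qed

lemma min_last_sum_take_eq:
  fixes xs :: "'a::linordered_ab_group_add list"
  assumes "\<forall>x \<in> set xs. 0 < x" "i < j" "j \<le> length xs" "key xs i \<le> prefix_sum xs j"
    and "\<And>k. i < k \<Longrightarrow> k < j \<Longrightarrow> prefix_sum xs j < key xs k"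
  shows "min_last_sum (take j xs) = prefix_sum xs j - prefix_sum xs i"
proof -
  have drop: "sum_list (drop k (take j xs)) = prefix_sum xs j - prefix_sum xs k" if "k < j" for k
    using that
    by (simp only: sum_list_drop prefix_sum_take less_imp_le) (simp add: prefix_sum_def)
  have "min_last_sum (take j xs) = sum_list (drop i (take j xs))"
  proof (rule min_last_sum_eq_sum_list_drop)
    show "\<forall>x \<in> set (take j xs). 0 < x" using assms(1) by (auto dest: in_set_takeD)
    show "min_last_sum (take i (take j xs)) \<le> sum_list (drop i (take j xs))"
      using assms(2,4) by (simp add: drop key_def algebra_simps min_def del: drop_take)
    fix k assume "i < k" "k < length (take j xs)"
    then have "k < j" by simp
    with assms(5)[OF \<open>i < k\<close> this]
    show "sum_list (drop k (take j xs)) < min_last_sum (take k (take j xs))"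
      by (simp add: drop key_def algebra_simps min_def del: drop_take)
  qed (use assms in simp)
  then show ?thesis using assms(2) by (simp only: drop)
qed


subsection \<open>The shortest wrapping\<close>

definition wrap_bound :: "real list \<Rightarrow> nat \<Rightarrow> real" where
  "wrap_bound ls i = max (min_last_sum (take i ls)) (sum_list (drop i ls))"

lemma wrappings_eq_UN_snoc:
  assumes "ls \<noteq> []"
  shows "wrappings ls =
    (\<Union>i<length ls. (\<lambda>bs. bs @ [drop i ls]) ` sorted_partitions (take i ls))"
proof -
  have "wrappings ls = {bs \<in> partitions ls. sorted (butlast (map sum_list bs))}"
    using assms by (auto simp: wrappings_def partitions_def)
  then show ?thesis
    unfolding partitions_eq_UN_snoc[OF assms] by (auto simp: sorted_partitions_def)
qed

lemma Max_set_sorted: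
  assumes "sorted xs" "xs \<noteq> []"
  shows "Max (set xs) = last xs"
  using assms by (cases xs rule: rev_cases) (auto simp: sorted_append intro: Max_eqI)

lemma wrap_length_snoc:
  assumes "sorted (map sum_list bs)" "0 \<le> sum_list b"
  shows "wrap_length (bs @ [b]) = max (last_sum bs) (sum_list b)"
  using Max_set_sorted[OF assms(1)] assms(2)
  by (cases "bs = []") (simp_all add: wrap_length_def last_sum_def max.commute)

lemma wrap_length_image_wrappings:
  assumes "ruler ls"
  shows "wrap_length ` wrappings ls = (\<Union>i<length ls.
    (\<lambda>bs. max (last_sum bs) (sum_list (drop i ls))) ` sorted_partitions (take i ls))"
proof -
  have "wrap_length (bs @ [drop i ls]) = max (last_sum bs) (sum_list (drop i ls))"
    if "i < length ls" "bs \<in> sorted_partitions (take i ls)" for i bs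
    using assms that sum_list_drop_pos[of ls i]
    by (intro wrap_length_snoc) (auto simp: ruler_def sorted_partitions_def)
  then show ?thesis
    using assms by (simp add: ruler_def wrappings_eq_UN_snoc image_UN image_image)
qed

lemma W_eq_Min_wrap_bound:
  assumes "ruler ls"
  shows "W ls = Min (wrap_bound ls ` {..<length ls})"
  unfolding W_def
proof (rule Min_eqI)
  have "wrap_bound ls i \<in> wrap_length ` wrappings ls" if "i < length ls" for i
    unfolding wrap_length_image_wrappings[OF assms] wrap_bound_def
    by (intro UN_I[of i]) (use that min_last_sum_in[of "take i ls"] in auto)
  moreover have "{..<length ls} \<noteq> {}" using assms by (auto simp: ruler_def)
  then have "Min (wrap_bound ls ` {..<length ls}) \<in> wrap_bound ls ` {..<length ls}"
    by (intro Min_in) auto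
  ultimately show "Min (wrap_bound ls ` {..<length ls}) \<in> wrap_length ` wrappings ls" by auto
next
  fix a assume "a \<in> wrap_length ` wrappings ls"
  then obtain i bs where "i < length ls" "bs \<in> sorted_partitions (take i ls)"
    "a = max (last_sum bs) (sum_list (drop i ls))"
    unfolding wrap_length_image_wrappings[OF assms] by auto
  then have "i < length ls" "wrap_bound ls i \<le> a"
    using min_last_sum_le[of bs "take i ls"] by (auto simp: wrap_bound_def)
  then show "Min (wrap_bound ls ` {..<length ls}) \<le> a"
    by (auto intro: Min.coboundedI[THEN order_trans])
qed (simp add: finite_wrappings)


subsection \<open>Monotone queues\<close>

text \<open>All positions below \<open>j\<close> that can still be the largest one with a key of at most \<open>x\<close>, now or
  for a later and larger \<open>x\<close>, are in the queue. The disjunct \<open>f j \<le> f i\<close> allows for the state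
  between removals at the back and the insertion of \<open>j\<close>.\<close>

definition candidate_queue ::
    "('a::linorder \<Rightarrow> 'b::linorder) \<Rightarrow> 'b \<Rightarrow> 'a \<Rightarrow> 'a list \<Rightarrow> bool" where
  "candidate_queue f x j qs \<longleftrightarrow>
     qs \<noteq> [] \<and> sorted_wrt (<) (qs @ [j]) \<and> sorted_wrt (<) (map f qs) \<and> f (hd qs) \<le> x \<and>
     (\<forall>i. hd qs \<le> i \<longrightarrow> i < j \<longrightarrow> f j \<le> f i \<or> (\<exists>k \<in> set qs. i \<le> k \<and> f k \<le> f i))"

lemma candidate_queue_elem_less: "candidate_queue f x j qs \<Longrightarrow> k \<in> set qs \<Longrightarrow> k < j"
  by (simp add: candidate_queue_def sorted_wrt_append)

lemma candidate_queue_dominated: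
  assumes "candidate_queue f x j qs" "hd qs \<le> i" "i < j"
  obtains (current) "f j \<le> f i" | (queued) k where "k \<in> set qs" "i \<le> k" "f k \<le> f i"
  using assms unfolding candidate_queue_def by blast

lemma candidate_queue_hd_greatest:
  assumes "candidate_queue f x j qs" "x < f j" "tl qs \<noteq> [] \<Longrightarrow> x < f (hd (tl qs))"
    and "hd qs < i" "i < j"
  shows "x < f i"
proof -
  obtain a ps where qs: "qs = a # ps"
    using assms(1) by (cases qs) (auto simp: candidate_queue_def)
  from assms(1) less_imp_le[OF assms(4)] assms(5) show ?thesis
  proof (cases rule: candidate_queue_dominated)
    case current
    with assms(2) show ?thesis by simp
  next
    case (queued k)
    with assms(4) have "k \<in> set ps" by (auto simp: qs)
    with assms(1,3) have "x < f k"
      by (cases ps) (auto simp: qs candidate_queue_def)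
    with queued show ?thesis by simp
  qed
qed

lemma candidate_queue_tl:
  assumes "candidate_queue f x j qs" "tl qs \<noteq> []" "f (hd (tl qs)) \<le> x"
  shows "candidate_queue f x j (tl qs)"
proof -
  obtain a b ps where qs: "qs = a # b # ps" using assms(2) by (cases qs; cases "tl qs") auto
  have "a < b" using assms(1) by (simp add: qs candidate_queue_def)
  have "f j \<le> f i \<or> (\<exists>k \<in> set (b # ps). i \<le> k \<and> f k \<le> f i)" if "b \<le> i" "i < j" for i
  proof -
    have "hd qs \<le> i" using \<open>a < b\<close> that by (simp add: qs)
    from assms(1) this that(2) show ?thesis
      by (cases rule: candidate_queue_dominated) (use \<open>a < b\<close> that in \<open>auto simp: qs\<close>)
  qed
  with assms(1,3) show ?thesis by (simp add: qs candidate_queue_def)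
qed

lemma candidate_queue_butlast:
  assumes "candidate_queue f x j qs" "x < f j" "f j \<le> f (last qs)"
  shows "candidate_queue f x j (butlast qs)"
proof -
  obtain ps b where qs: "qs = ps @ [b]"
    using assms(1) by (cases qs rule: rev_cases) (auto simp: candidate_queue_def)
  have ps: "ps \<noteq> []" using assms by (auto simp: qs candidate_queue_def)
  have "f j \<le> f i \<or> (\<exists>k \<in> set ps. i \<le> k \<and> f k \<le> f i)" if "hd qs \<le> i" "i < j" for i
    using assms(1) that
    by (cases rule: candidate_queue_dominated) (use assms(3) in \<open>auto simp: qs\<close>)
  with assms(1) ps show ?thesis
    by (simp add: qs candidate_queue_def sorted_wrt_append)
qed

lemma candidate_queue_snoc:
  fixes f :: "nat \<Rightarrow> 'a::linorder"
  assumes "candidate_queue f x j qs" "f (last qs) < f j" "x \<le> y"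
  shows "candidate_queue f y (Suc j) (qs @ [j])"
proof -
  obtain ps b where qs: "qs = ps @ [b]"
    using assms(1) by (cases qs rule: rev_cases) (auto simp: candidate_queue_def)
  have "\<exists>k \<in> set (qs @ [j]). i \<le> k \<and> f k \<le> f i" if "hd qs \<le> i" "i < Suc j" for i
  proof (cases "i = j")
    case False
    with that have "i < j" by simp
    from assms(1) that(1) this show ?thesis
      by (cases rule: candidate_queue_dominated) (use \<open>i < j\<close> in auto)
  qed simp
  moreover have "sorted_wrt (<) (map f (qs @ [j]))"
    using assms(1,2) by (auto simp: qs candidate_queue_def sorted_wrt_append)
  moreover have "sorted_wrt (<) (qs @ [j])" "qs \<noteq> []" "f (hd qs) \<le> y"
    using assms(1,3) by (auto simp: candidate_queue_def)
  ultimately show ?thesis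
    by (simp add: candidate_queue_def sorted_wrt_append less_Suc_eq)
qed

subsection \<open>Timed total correctness\<close>

definition terminates_within :: "com \<Rightarrow> state \<Rightarrow> nat \<Rightarrow> (state \<Rightarrow> bool) \<Rightarrow> bool" where
  "terminates_within c s T Q \<longleftrightarrow> (\<exists>t s'. exec c s t s' \<and> t \<le> T \<and> Q s')"

lemma terminates_within_mono:
  "terminates_within c s T P \<Longrightarrow> T \<le> U \<Longrightarrow> (\<And>s. P s \<Longrightarrow> Q s) \<Longrightarrow> terminates_within c s U Q"
  unfolding terminates_within_def by (meson order_trans)

lemma terminates_within_Seq:
  assumes "terminates_within c s T P" "\<And>s. P s \<Longrightarrow> terminates_within d s U Q"
  shows "terminates_within (Seq c d) s (T + U) Q"
  using assms unfolding terminates_within_def by (meson add_mono exec.Seq)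

lemma terminates_within_Cond:
  assumes "bval b s \<Longrightarrow> terminates_within c s T Q" "\<not> bval b s \<Longrightarrow> terminates_within d s T Q"
  shows "terminates_within (Cond b c d) s (bcost b + T + 1) Q"
  using assms unfolding terminates_within_def
  by (cases "bval b s") (meson add_le_mono exec.CondTrue exec.CondFalse le_refl)+

definition while_time :: "bexp \<Rightarrow> nat \<Rightarrow> nat \<Rightarrow> nat" where
  "while_time b K m = m * (bcost b + K + 1) + bcost b + 1"

lemma while_time_mono: "m \<le> n \<Longrightarrow> while_time b K m \<le> while_time b K n"
  unfolding while_time_def by (intro add_le_mono mult_le_mono) simp_all

lemma terminates_within_While:
  fixes m :: "state \<Rightarrow> nat"
  assumes step: "\<And>s. I s \<Longrightarrow> bval b s \<Longrightarrow> terminates_within c s K (\<lambda>s'. I s' \<and> m s' < m s)"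
    and "I s"
  shows "terminates_within (While b c) s (while_time b K (m s)) (\<lambda>s'. I s' \<and> \<not> bval b s')"
  using assms(2)
proof (induction "m s" arbitrary: s rule: less_induct)
  case less
  show ?case
  proof (cases "bval b s")
    case False
    with less.prems exec.WhileFalse[OF False] show ?thesis
      unfolding terminates_within_def while_time_def by fastforce
  next
    case True
    with step less.prems obtain t s' where body: "exec c s t s'" "t \<le> K" "I s'" "m s' < m s"
      unfolding terminates_within_def by blast
    with less.hyps obtain u s'' where rest: "exec (While b c) s' u s''"
      "u \<le> while_time b K (m s')" "I s''" "\<not> bval b s''"
      unfolding terminates_within_def by blast
    have "u \<le> while_time b K (m s - 1)"
      using rest(2) body(4) while_time_mono[of "m s'" "m s - 1" b K] by linarith
    with body(2,4) have "bcost b + t + u + 1 \<le> while_time b K (m s)"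
      by (cases "m s") (simp_all add: while_time_def)
    with exec.WhileTrue[OF True body(1) rest(1)] rest(3,4) show ?thesis
      unfolding terminates_within_def by blast
  qed
qed

primrec loop_free :: "com \<Rightarrow> bool" where
  "loop_free Skip = True"
| "loop_free (NAssign x e) = True"
| "loop_free (RAssign x e) = True"
| "loop_free (NStore a i e) = True"
| "loop_free (RStore a i e) = True"
| "loop_free (Seq c d) = (loop_free c \<and> loop_free d)"
| "loop_free (Cond b c d) = (loop_free c \<and> loop_free d)"
| "loop_free (While b c) = False"

text \<open>The values of \<open>effect\<close> and \<open>cost_bound\<close> on loops are irrelevant.\<close>

primrec effect :: "com \<Rightarrow> state \<Rightarrow> state" where
  "effect Skip s = s"
| "effect (NAssign x e) s = s\<lparr>nvar := (nvar s)(x := nval e s)\<rparr>"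
| "effect (RAssign x e) s = s\<lparr>rvar := (rvar s)(x := rval e s)\<rparr>"
| "effect (NStore a i e) s = s\<lparr>narr := (narr s)(a := (narr s a)(nval i s := nval e s))\<rparr>"
| "effect (RStore a i e) s = s\<lparr>rarr := (rarr s)(a := (rarr s a)(nval i s := rval e s))\<rparr>"
| "effect (Seq c d) s = effect d (effect c s)"
| "effect (Cond b c d) s = (if bval b s then effect c s else effect d s)"
| "effect (While b c) s = s"

primrec cost_bound :: "com \<Rightarrow> nat" where
  "cost_bound Skip = 1"
| "cost_bound (NAssign x e) = ncost e + 1"
| "cost_bound (RAssign x e) = rcost e + 1"
| "cost_bound (NStore a i e) = ncost i + ncost e + 1"
| "cost_bound (RStore a i e) = ncost i + rcost e + 1"
| "cost_bound (Seq c d) = cost_bound c + cost_bound d"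
| "cost_bound (Cond b c d) = bcost b + max (cost_bound c) (cost_bound d) + 1"
| "cost_bound (While b c) = 0"

lemma terminates_within_loop_free:
  "loop_free c \<Longrightarrow> terminates_within c s (cost_bound c) (\<lambda>s'. s' = effect c s)"
proof (induction c arbitrary: s)
  case (Seq c d)
  then show ?case by (auto intro: terminates_within_Seq)
next
  case (Cond b c d)
  then have "terminates_within c s (cost_bound c) (\<lambda>s'. s' = effect c s)"
    "terminates_within d s (cost_bound d) (\<lambda>s'. s' = effect d s)"
    by simp_all
  then show ?case
    unfolding cost_bound.simps
    by (intro terminates_within_Cond) (auto elim: terminates_within_mono)
qed (auto simp: terminates_within_def intro: exec.intros exec.Skip[simplified])


subsection \<open>The algorithm\<close>

notation Seq (infixr ";;" 60)

abbreviation incr :: "vname \<Rightarrow> com" where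
  "incr x \<equiv> NAssign x (NAdd (NVar x) (NConst 1))"

abbreviation decr :: "vname \<Rightarrow> com" where
  "decr x \<equiv> NAssign x (NSub (NVar x) (NConst 1))"

definition sum_test :: bexp where
  "sum_test = NLess (NVar ''i'') (NVar ''n'')"

definition sum_body :: com where
  "sum_body =
     RStore ''sum'' (NAdd (NVar ''i'') (NConst 1))
       (RAdd (RArr ''sum'' (NVar ''i'')) (RArr ''input'' (NVar ''i''))) ;;
     incr ''i''"

definition queue_init :: com where
  "queue_init =
     NStore ''queue'' (NConst 0) (NConst 0) ;; NAssign ''head'' (NConst 0) ;;
     NAssign ''tail'' (NConst 1) ;; RStore ''key'' (NConst 0) RZero ;;
     RAssign ''output'' (RArr ''sum'' (NVar ''n'')) ;; NAssign ''j'' (NConst 1)"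

definition queue_test :: bexp where
  "queue_test = NLess (NVar ''j'') (NVar ''n'')"

definition front_test :: bexp where
  "front_test =
     BAnd (NLess (NAdd (NVar ''head'') (NConst 1)) (NVar ''tail''))
       (BNot (RLess (RArr ''sum'' (NVar ''j''))
          (RArr ''key'' (NArr ''queue'' (NAdd (NVar ''head'') (NConst 1))))))"

definition store_key :: com where
  "store_key =
     RStore ''key'' (NVar ''j'') (RAdd (RArr ''sum'' (NVar ''j''))
       (RSub (RArr ''sum'' (NVar ''j'')) (RArr ''sum'' (NArr ''queue'' (NVar ''head'')))))"

definition back_test :: bexp where
  "back_test =
     BNot (RLess (RArr ''key'' (NArr ''queue'' (NSub (NVar ''tail'') (NConst 1))))
       (RArr ''key'' (NVar ''j'')))"

definition update_output :: com where
  "update_output =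
     RAssign ''bound'' (RSub (RArr ''sum'' (NVar ''n'')) (RArr ''sum'' (NVar ''j''))) ;;
     RAssign ''last'' (RSub (RArr ''key'' (NVar ''j'')) (RArr ''sum'' (NVar ''j''))) ;;
     Cond (RLess (RVar ''bound'') (RVar ''last'')) (RAssign ''bound'' (RVar ''last'')) Skip ;;
     Cond (RLess (RVar ''bound'') (RVar ''output'')) (RAssign ''output'' (RVar ''bound'')) Skip"

definition push :: com where
  "push = NStore ''queue'' (NVar ''tail'') (NVar ''j'') ;; incr ''tail'' ;; incr ''j''"

text \<open>Doing at most one queue operation per iteration avoids nested loops.\<close>

definition queue_body :: com where
  "queue_body =
     Cond front_test (incr ''head'')
       (store_key ;; Cond back_test (decr ''tail'') (update_output ;; push))"

definition wrap_prog :: com where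
  "wrap_prog = While sum_test sum_body ;; queue_init ;; While queue_test queue_body"

definition wrap_time :: "nat \<Rightarrow> nat" where
  "wrap_time n = while_time sum_test (cost_bound sum_body) n +
     (cost_bound queue_init + while_time queue_test (cost_bound queue_body) (2 * n))"

definition sums_upto :: "real list \<Rightarrow> state \<Rightarrow> nat \<Rightarrow> bool" where
  "sums_upto ls s m \<longleftrightarrow> nvar s ''n'' = length ls \<and> m \<le> length ls \<and>
     (\<forall>i \<le> m. rarr s ''sum'' i = prefix_sum ls i)"

definition sum_inv :: "real list \<Rightarrow> state \<Rightarrow> bool" where
  "sum_inv ls s \<longleftrightarrow>
     sums_upto ls s (nvar s ''i'') \<and> (\<forall>i < length ls. rarr s ''input'' i = ls ! i)"

definition queue_of :: "state \<Rightarrow> nat list" where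
  "queue_of s = map (narr s ''queue'') [nvar s ''head''..<nvar s ''tail'']"

definition queue_inv :: "real list \<Rightarrow> state \<Rightarrow> bool" where
  "queue_inv ls s \<longleftrightarrow>
     sums_upto ls s (length ls) \<and> 0 < nvar s ''j'' \<and> nvar s ''j'' \<le> length ls \<and>
     (\<forall>i < nvar s ''j''. rarr s ''key'' i = key ls i) \<and>
     candidate_queue (key ls) (prefix_sum ls (nvar s ''j'')) (nvar s ''j'') (queue_of s) \<and>
     rvar s ''output'' = Min (wrap_bound ls ` {..<nvar s ''j''})"

definition key_stored :: "real list \<Rightarrow> state \<Rightarrow> bool" where
  "key_stored ls s \<longleftrightarrow> rarr s ''key'' (nvar s ''j'') = key ls (nvar s ''j'')"

definition queue_measure :: "state \<Rightarrow> nat" where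
  "queue_measure s = 2 * (nvar s ''n'' - nvar s ''j'') + length (queue_of s)"

lemma sum_inv_initial: "sum_inv ls (initial ls)"
  by (simp add: sum_inv_def sums_upto_def initial_def)

lemma sum_inv_step:
  assumes "sum_inv ls s" "bval sum_test s"
  shows "sum_inv ls (effect sum_body s)"
    "length ls - nvar (effect sum_body s) ''i'' < length ls - nvar s ''i''"
  using assms
  by (auto simp: sum_inv_def sums_upto_def sum_test_def sum_body_def prefix_sum_Suc le_Suc_eq)

lemma sums_upto_length_if_sum_inv:
  "sum_inv ls s \<Longrightarrow> \<not> bval sum_test s \<Longrightarrow> sums_upto ls s (length ls)"
  by (auto simp: sum_inv_def sums_upto_def sum_test_def)

lemma queue_inv_init:
  assumes "ruler ls" "sums_upto ls s (length ls)"
  shows "queue_inv ls (effect queue_init s)" "queue_measure (effect queue_init s) \<le> 2 * length ls"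
proof -
  have pos: "\<forall>l \<in> set ls. 0 < l" and len: "0 < length ls" using assms(1) by (auto simp: ruler_def)
  have "0 < prefix_sum ls 1" "0 \<le> sum_list ls"
    using prefix_sum_strict_mono[OF pos, of 0 1] prefix_sum_strict_mono[OF pos len] len
    by simp_all
  moreover have "{..<Suc 0} = {0}" by auto
  moreover have "queue_of (effect queue_init s) = [0]"
    by (simp add: queue_of_def queue_init_def)
  ultimately show "queue_inv ls (effect queue_init s)"
    using assms(2) len
    by (simp add: queue_inv_def queue_init_def sums_upto_def candidate_queue_def wrap_bound_def
        Suc_le_eq)
  show "queue_measure (effect queue_init s) \<le> 2 * length ls"
    using assms(2) len
    by (simp add: queue_measure_def queue_of_def queue_init_def sums_upto_def
        del: length_greater_0_conv)
qed

lemma queue_nonempty_if_inv: "queue_inv ls s \<Longrightarrow> nvar s ''head'' < nvar s ''tail''"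
  by (auto simp: queue_inv_def candidate_queue_def queue_of_def)

lemma rarr_key_queue:
  assumes "queue_inv ls s" "nvar s ''head'' \<le> k" "k < nvar s ''tail''"
  shows "rarr s ''key'' (narr s ''queue'' k) = key ls (narr s ''queue'' k)"
proof -
  have "narr s ''queue'' k \<in> set (queue_of s)" using assms(2,3) by (simp add: queue_of_def)
  then have "narr s ''queue'' k < nvar s ''j''"
    using assms(1) candidate_queue_elem_less unfolding queue_inv_def by blast
  with assms(1) show ?thesis by (simp add: queue_inv_def)
qed

lemma front_test_iff:
  assumes "queue_inv ls s"
  shows "bval front_test s \<longleftrightarrow> tl (queue_of s) \<noteq> [] \<and>
    key ls (hd (tl (queue_of s))) \<le> prefix_sum ls (nvar s ''j'')"
  using assms rarr_key_queue[OF assms, of "Suc (nvar s ''head'')"]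
  by (auto simp: front_test_def queue_of_def map_tl[symmetric] hd_map queue_inv_def sums_upto_def)

lemma back_test_iff:
  assumes "queue_inv ls s" "key_stored ls s"
  shows "bval back_test s \<longleftrightarrow> key ls (nvar s ''j'') \<le> key ls (last (queue_of s))"
  using assms(2) queue_nonempty_if_inv[OF assms(1)]
    rarr_key_queue[OF assms(1), of "nvar s ''tail'' - 1"]
  by (auto simp: back_test_def queue_of_def last_map key_stored_def)

lemma queue_inv_incr_head:
  assumes "queue_inv ls s" "bval front_test s"
  shows "queue_inv ls (effect (incr ''head'') s)"
    "queue_measure (effect (incr ''head'') s) < queue_measure s"
proof -
  have queue: "queue_of (effect (incr ''head'') s) = tl (queue_of s)"
    by (simp add: queue_of_def map_tl[symmetric])
  have "candidate_queue (key ls) (prefix_sum ls (nvar s ''j'')) (nvar s ''j'') (tl (queue_of s))"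
    using assms front_test_iff[OF assms(1)]
    by (intro candidate_queue_tl) (simp_all add: queue_inv_def)
  with assms(1) show "queue_inv ls (effect (incr ''head'') s)"
    unfolding queue_inv_def queue by (simp add: sums_upto_def)
  show "queue_measure (effect (incr ''head'') s) < queue_measure s"
    using queue_nonempty_if_inv[OF assms(1)] by (simp add: queue_measure_def queue_of_def)
qed

lemma queue_inv_decr_tail:
  assumes "ruler ls" "queue_inv ls s" "key_stored ls s" "bval back_test s"
  shows "queue_inv ls (effect (decr ''tail'') s)"
    "queue_measure (effect (decr ''tail'') s) < queue_measure s"
proof -
  have queue: "queue_of (effect (decr ''tail'') s) = butlast (queue_of s)"
    using queue_nonempty_if_inv[OF assms(2)]
    by (cases "nvar s ''tail''") (simp_all add: queue_of_def)
  have "prefix_sum ls (nvar s ''j'') < key ls (nvar s ''j'')"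
    using assms(1,2) by (intro prefix_sum_less_key) (auto simp: ruler_def queue_inv_def)
  then have "candidate_queue (key ls) (prefix_sum ls (nvar s ''j'')) (nvar s ''j'')
      (butlast (queue_of s))"
    using assms(2,4) back_test_iff[OF assms(2,3)]
    by (intro candidate_queue_butlast) (simp_all add: queue_inv_def)
  with assms(2) show "queue_inv ls (effect (decr ''tail'') s)"
    unfolding queue_inv_def queue by (simp add: sums_upto_def)
  show "queue_measure (effect (decr ''tail'') s) < queue_measure s"
    using queue_nonempty_if_inv[OF assms(2)] by (simp add: queue_measure_def queue_of_def)
qed

lemma queue_inv_store_key:
  assumes "ruler ls" "queue_inv ls s" "\<not> bval front_test s"
  shows "queue_inv ls (effect store_key s)" "key_stored ls (effect store_key s)"
proof -
  let ?j = "nvar s ''j''" and ?front = "narr s ''queue'' (nvar s ''head'')"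
  have pos: "\<forall>l \<in> set ls. 0 < l" using assms(1) by (simp add: ruler_def)
  have j: "0 < ?j" "?j \<le> length ls"
    and queue: "candidate_queue (key ls) (prefix_sum ls ?j) ?j (queue_of s)"
    and sums: "\<And>i. i \<le> length ls \<Longrightarrow> rarr s ''sum'' i = prefix_sum ls i"
    using assms(2) by (auto simp: queue_inv_def sums_upto_def)
  have hd: "hd (queue_of s) = ?front" and "?front \<in> set (queue_of s)"
    using queue_nonempty_if_inv[OF assms(2)] by (simp_all add: queue_of_def hd_map)
  then have front: "?front < ?j" using candidate_queue_elem_less[OF queue] by blast
  have "min_last_sum (take ?j ls) = prefix_sum ls ?j - prefix_sum ls ?front"
  proof (rule min_last_sum_take_eq[OF pos front j(2)])
    show "key ls ?front \<le> prefix_sum ls ?j" using queue by (simp add: candidate_queue_def hd)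
    show "prefix_sum ls ?j < key ls k" if "?front < k" "k < ?j" for k
      using candidate_queue_hd_greatest[OF queue prefix_sum_less_key[OF pos j]] that
        front_test_iff[OF assms(2)] assms(3) by (force simp: hd)
  qed
  with j(2) front show "key_stored ls (effect store_key s)"
    by (simp add: key_stored_def store_key_def sums key_def)
  show "queue_inv ls (effect store_key s)"
    using assms(2) by (simp add: store_key_def queue_inv_def queue_of_def sums_upto_def)
qed

lemma rvar_output_update_output:
  assumes "queue_inv ls s" "key_stored ls s"
  shows "rvar (effect update_output s) ''output'' =
    Min (wrap_bound ls ` {..<Suc (nvar s ''j'')})"
proof -
  have "rvar (effect update_output s) ''output'' =
      min (wrap_bound ls (nvar s ''j'')) (rvar s ''output'')"
    using assms
    by (auto simp: update_output_def queue_inv_def sums_upto_def key_stored_def key_def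
        wrap_bound_def sum_list_drop)
  also have "\<dots> = Min (wrap_bound ls ` {..<Suc (nvar s ''j'')})"
  proof -
    have "{..<nvar s ''j''} \<noteq> {}" using assms(1) by (auto simp: queue_inv_def)
    with assms(1) show ?thesis by (simp add: queue_inv_def lessThan_Suc)
  qed
  finally show ?thesis .
qed

lemma effect_update_output [simp]:
  "nvar (effect update_output s) = nvar s" "narr (effect update_output s) = narr s"
  "rarr (effect update_output s) = rarr s"
  by (simp_all add: update_output_def)

lemma queue_inv_push:
  assumes "ruler ls" "queue_inv ls s" "key_stored ls s"
    and "bval queue_test s" "\<not> bval back_test s"
  shows "queue_inv ls (effect (update_output ;; push) s)"
    "queue_measure (effect (update_output ;; push) s) < queue_measure s"
proof -
  let ?j = "nvar s ''j''" and ?s = "effect (update_output ;; push) s"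
  have pos: "\<forall>l \<in> set ls. 0 < l" using assms(1) by (simp add: ruler_def)
  have j: "?j < length ls" and n: "nvar s ''n'' = length ls"
    using assms(2,4) by (simp_all add: queue_inv_def sums_upto_def queue_test_def)
  have queue: "queue_of ?s = queue_of s @ [?j]"
    using queue_nonempty_if_inv[OF assms(2)] by (simp add: queue_of_def push_def)
  have "candidate_queue (key ls) (prefix_sum ls (Suc ?j)) (Suc ?j) (queue_of s @ [?j])"
  proof (rule candidate_queue_snoc)
    show "candidate_queue (key ls) (prefix_sum ls ?j) ?j (queue_of s)"
      using assms(2) by (simp add: queue_inv_def)
    show "key ls (last (queue_of s)) < key ls ?j"
      using assms(5) back_test_iff[OF assms(2,3)] by simp
    show "prefix_sum ls ?j \<le> prefix_sum ls (Suc ?j)"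
      using prefix_sum_strict_mono[OF pos, of ?j "Suc ?j"] j by simp
  qed
  then show "queue_inv ls ?s"
    using assms(2,3) j rvar_output_update_output[OF assms(2,3)] queue
    by (simp add: queue_inv_def key_stored_def push_def sums_upto_def less_Suc_eq)
  show "queue_measure ?s < queue_measure s"
    unfolding queue_measure_def queue using j n by (simp add: push_def)
qed

lemma queue_inv_step:
  assumes "ruler ls" "queue_inv ls s" "bval queue_test s"
  shows "queue_inv ls (effect queue_body s) \<and>
    queue_measure (effect queue_body s) < queue_measure s"
proof (cases "bval front_test s")
  case True
  with queue_inv_incr_head[OF assms(2)] show ?thesis by (simp add: queue_body_def)
next
  case False
  let ?s = "effect store_key s"
  have unchanged: "nvar ?s = nvar s" "queue_measure ?s = queue_measure s"
    by (simp_all add: store_key_def queue_measure_def queue_of_def)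
  have inv: "queue_inv ls ?s" "key_stored ls ?s"
    using queue_inv_store_key[OF assms(1,2) False] by simp_all
  have not_done: "bval queue_test ?s"
    using assms(3) by (simp add: unchanged queue_test_def)
  have "effect queue_body s = (if bval back_test ?s then effect (decr ''tail'') ?s
      else effect (update_output ;; push) ?s)"
    using False by (simp add: queue_body_def)
  with queue_inv_decr_tail[OF assms(1) inv] queue_inv_push[OF assms(1) inv not_done]
  show ?thesis by (simp add: unchanged)
qed

lemma sum_loop_correct:
  "terminates_within (While sum_test sum_body) (initial ls)
     (while_time sum_test (cost_bound sum_body) (length ls)) (\<lambda>s. sums_upto ls s (length ls))"
proof (rule terminates_within_mono)
  show "terminates_within (While sum_test sum_body) (initial ls)
      (while_time sum_test (cost_bound sum_body) (length ls - nvar (initial ls) ''i''))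
      (\<lambda>s. sum_inv ls s \<and> \<not> bval sum_test s)"
  proof (rule terminates_within_While[where m = "\<lambda>s. length ls - nvar s ''i''"])
    show "sum_inv ls (initial ls)" by (rule sum_inv_initial)
  next
    fix s assume "sum_inv ls s" "bval sum_test s"
    with sum_inv_step show "terminates_within sum_body s (cost_bound sum_body)
        (\<lambda>s'. sum_inv ls s' \<and> length ls - nvar s' ''i'' < length ls - nvar s ''i'')"
      by (intro terminates_within_mono[OF terminates_within_loop_free]) (auto simp: sum_body_def)
  qed
qed (auto simp: while_time_mono sums_upto_length_if_sum_inv)

lemma queue_loop_correct:
  assumes "ruler ls" "queue_inv ls s"
  shows "terminates_within (While queue_test queue_body) s
    (while_time queue_test (cost_bound queue_body) (queue_measure s)) (\<lambda>s. result_of s = W ls)"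
proof (rule terminates_within_mono)
  show "terminates_within (While queue_test queue_body) s
      (while_time queue_test (cost_bound queue_body) (queue_measure s))
      (\<lambda>s. queue_inv ls s \<and> \<not> bval queue_test s)"
  proof (rule terminates_within_While)
    show "queue_inv ls s" by (rule assms(2))
  next
    have "loop_free queue_body"
      by (simp add: queue_body_def store_key_def update_output_def push_def)
    then show "terminates_within queue_body s (cost_bound queue_body)
        (\<lambda>s'. queue_inv ls s' \<and> queue_measure s' < queue_measure s)"
      if "queue_inv ls s" "bval queue_test s" for s
      using queue_inv_step[OF assms(1) that]
      by (intro terminates_within_mono[OF terminates_within_loop_free]) auto
  qed
  fix s assume s: "queue_inv ls s \<and> \<not> bval queue_test s"
  then have "nvar s ''j'' = length ls"
    by (auto simp: queue_inv_def sums_upto_def queue_test_def)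
  with s show "result_of s = W ls"
    by (simp add: queue_inv_def result_of_def W_eq_Min_wrap_bound[OF assms(1)])
qed simp

lemma wrap_prog_correct:
  assumes "ruler ls"
  shows "terminates_within wrap_prog (initial ls) (wrap_time (length ls))
    (\<lambda>s. result_of s = W ls)"
  unfolding wrap_prog_def wrap_time_def
proof (intro terminates_within_Seq)
  show "terminates_within (While sum_test sum_body) (initial ls)
      (while_time sum_test (cost_bound sum_body) (length ls)) (\<lambda>s. sums_upto ls s (length ls))"
    by (rule sum_loop_correct)
next
  fix s assume "sums_upto ls s (length ls)"
  with queue_inv_init[OF assms] show "terminates_within queue_init s (cost_bound queue_init)
      (\<lambda>s. queue_inv ls s \<and> queue_measure s \<le> 2 * length ls)"
    by (intro terminates_within_mono[OF terminates_within_loop_free]) (auto simp: queue_init_def)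
next
  fix s assume "queue_inv ls s \<and> queue_measure s \<le> 2 * length ls"
  with queue_loop_correct[OF assms] while_time_mono
  show "terminates_within (While queue_test queue_body) s
      (while_time queue_test (cost_bound queue_body) (2 * length ls)) (\<lambda>s. result_of s = W ls)"
    by (blast intro: terminates_within_mono)
qed

lemma const_in_bigo_real: "(\<lambda>_. c) \<in> O(\<lambda>n. real n)"
  by (intro bigoI[of _ "norm c"] eventually_sequentiallyI[of 1])
    (simp add: mult_le_cancel_left1)

lemma while_time_bigo: "(\<lambda>n. real (while_time b K (a * n))) \<in> O(\<lambda>n. real n)"
  unfolding while_time_def by (auto intro!: sum_in_bigo const_in_bigo_real)

lemma wrap_time_bigo: "(\<lambda>n. real (wrap_time n)) \<in> O(\<lambda>n. real n)"
  using while_time_bigo[of sum_test "cost_bound sum_body" 1]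
  unfolding wrap_time_def by (auto intro!: sum_in_bigo const_in_bigo_real while_time_bigo)

theorem theorem3:
  "\<exists>(prog :: com) (T :: nat \<Rightarrow> nat).
     (\<lambda>n. real (T n)) \<in> O(\<lambda>n. real n) \<and>
     (\<forall>ls :: real list. ruler ls \<longrightarrow>
        (\<exists>t s. exec prog (initial ls) t s \<and> t \<le> T (length ls) \<and> result_of s = W ls))"
  using wrap_time_bigo wrap_prog_correct unfolding terminates_within_def by blast

end
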